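(* Let $\Gamma$ be a tropical curve and $D$ a divisor on $\Gamma$. The space $R(D)$ is a tropical semi-module, i.e. it is closed under tropical addition and tropical scalar multiplication: if $f,g\in R(D)$ and $a\in\mathbb R$, then $f\oplus g\in R(D)$ and $a\odot f\in R(D)$.
   Context: A tropical curve $\Gamma$ is a compact connected metric graph whose leaf edges may have infinite length (with a point at infinity added). Divisors are finite formal $\mathbb Z$-combinations of points. A rational function is a continuous function on $\Gamma$, piecewise linear with finitely many pieces and integer slopes (real-valued, except possibly $\pm\infty$ at points at infinity); $(f)=\sum_x\mathrm{ord}_x(f)\cdot x$, where $\mathrm{ord}_x(f)$ is the sum of outgoing slopes at $x$. $R(D)$ is the set of rational functions $f$ such that all coefficients of $D+(f)$ are $\ge0$. Tropical operations are pointwise: $(f\oplus g)(x)=\max(f(x),g(x))$ and $(a\odot f)(x)=a+f(x)$. *)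

theory Defs
  imports "HOL-Analysis.Analysis" "HOL-Library.Poly_Mapping"
begin

text \<open>
  A tropical curve is a topological space together with a finite model: a finite vertex set,
  finitely many edges, and for each edge an arc-length parametrisation by a closed interval
  of extended reals from 0 to the length of the edge.
\<close>

record ('p, 'e) metric_graph =
  topol :: "'p topology"
  verts :: "'p set"
  edges :: "'e set"
  elen :: "'e \<Rightarrow> ereal"
  chart :: "'e \<Rightarrow> ereal \<Rightarrow> 'p"

abbreviation points :: "('p, 'e) metric_graph \<Rightarrow> 'p set" where
  "points \<Gamma> \<equiv> topspace (topol \<Gamma>)"

text \<open>
  Since the space is compact Hausdorff and covered by the vertices and the finitely many
  closed edges, its topology is the quotient topology obtained by gluing the edges at the
  vertices. Loops and multiple edges are allowed. An edge of infinite length is a leaf edge,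
  parametrised such that the leaf (the point at infinity) has parameter \<open>\<infinity>\<close>. A curve that is
  unbounded at both ends of a segment is modelled with an additional vertex of valence 2.
\<close>

definition tropical_curve :: "('p, 'e) metric_graph \<Rightarrow> bool" where
  "tropical_curve \<Gamma> \<longleftrightarrow>
     compact_space (topol \<Gamma>) \<and> Hausdorff_space (topol \<Gamma>) \<and> connected_space (topol \<Gamma>) \<and>
     points \<Gamma> \<noteq> {} \<and>
     finite (verts \<Gamma>) \<and> verts \<Gamma> \<subseteq> points \<Gamma> \<and> finite (edges \<Gamma>) \<and>
     (\<forall>e\<in>edges \<Gamma>.
        0 < elen \<Gamma> e \<and>
        continuous_map (top_of_set {0..elen \<Gamma> e}) (topol \<Gamma>) (chart \<Gamma> e) \<and>
        chart \<Gamma> e 0 \<in> verts \<Gamma> \<and> chart \<Gamma> e (elen \<Gamma> e) \<in> verts \<Gamma>) \<and>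
     bij_betw (\<lambda>(e, t). chart \<Gamma> e t) (SIGMA e:edges \<Gamma>. {0<..<elen \<Gamma> e})
       (points \<Gamma> - verts \<Gamma>) \<and>
     (\<forall>e\<in>edges \<Gamma>. elen \<Gamma> e = \<infinity> \<longrightarrow>
        (\<forall>e'\<in>edges \<Gamma>. \<forall>t\<in>{0..elen \<Gamma> e'}. chart \<Gamma> e' t = chart \<Gamma> e \<infinity> \<longrightarrow> e' = e \<and> t = \<infinity>))"

definition points_at_infinity :: "('p, 'e) metric_graph \<Rightarrow> 'p set" where
  "points_at_infinity \<Gamma> = {chart \<Gamma> e \<infinity> |e. e \<in> edges \<Gamma> \<and> elen \<Gamma> e = \<infinity>}"

definition affine_between :: "(ereal \<Rightarrow> ereal) \<Rightarrow> ereal \<Rightarrow> ereal \<Rightarrow> bool" where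
  "affine_between h a b \<longleftrightarrow>
     (\<exists>(m::int) (c::real). \<forall>s\<in>{a<..<b}. h s = ereal (c + of_int m * real_of_ereal s))"

text \<open>The finite set \<open>B\<close> contains the break points of \<open>f\<close> on the edge.\<close>

definition piecewise_linear :: "('p, 'e) metric_graph \<Rightarrow> ('p \<Rightarrow> ereal) \<Rightarrow> bool" where
  "piecewise_linear \<Gamma> f \<longleftrightarrow>
     (\<forall>e\<in>edges \<Gamma>. \<exists>B. finite B \<and>
        (\<forall>a b. {a<..<b} \<subseteq> {0<..<elen \<Gamma> e} - B \<longrightarrow> affine_between (\<lambda>s. f (chart \<Gamma> e s)) a b))"

text \<open>Only the values of a rational function on \<open>points \<Gamma>\<close> are relevant.\<close>

definition rational_function :: "('p, 'e) metric_graph \<Rightarrow> ('p \<Rightarrow> ereal) \<Rightarrow> bool" where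
  "rational_function \<Gamma> f \<longleftrightarrow>
     continuous_map (topol \<Gamma>) euclidean f \<and>
     (\<forall>x\<in>points \<Gamma> - points_at_infinity \<Gamma>. \<bar>f x\<bar> \<noteq> \<infinity>) \<and>
     piecewise_linear \<Gamma> f"

datatype direction = Forward | Backward

text \<open>
  A tangent direction at \<open>x\<close> consists of an edge, a parameter \<open>t\<close> at which the edge meets \<open>x\<close>,
  and a direction in which \<open>t\<close> can be moved along the edge.
\<close>

definition tangents :: "('p, 'e) metric_graph \<Rightarrow> 'p \<Rightarrow> ('e \<times> ereal \<times> direction) set" where
  "tangents \<Gamma> x =
     {(e, t, Forward) |e t. e \<in> edges \<Gamma> \<and> 0 \<le> t \<and> t < elen \<Gamma> e \<and> chart \<Gamma> e t = x} \<union>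
     {(e, t, Backward) |e t. e \<in> edges \<Gamma> \<and> 0 < t \<and> t \<le> elen \<Gamma> e \<and> chart \<Gamma> e t = x}"

text \<open>
  The derivative of \<open>h\<close> near \<open>t\<close> on the side given by the filter. At \<open>t = \<infinity>\<close> the filter
  \<open>at_left \<infinity>\<close> is about all sufficiently large parameters, so this is the slope of the
  unbounded piece.
\<close>

definition slope_along :: "(ereal \<Rightarrow> ereal) \<Rightarrow> ereal filter \<Rightarrow> int" where
  "slope_along h F =
     (THE m. \<exists>c::real. \<forall>\<^sub>F s in F. h s = ereal (c + of_int m * real_of_ereal s))"

fun outgoing_slope ::
  "('p, 'e) metric_graph \<Rightarrow> ('p \<Rightarrow> ereal) \<Rightarrow> 'e \<times> ereal \<times> direction \<Rightarrow> int" where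
  "outgoing_slope \<Gamma> f (e, t, Forward) = slope_along (\<lambda>s. f (chart \<Gamma> e s)) (at_right t)"
| "outgoing_slope \<Gamma> f (e, t, Backward) = - slope_along (\<lambda>s. f (chart \<Gamma> e s)) (at_left t)"

definition ord_at :: "('p, 'e) metric_graph \<Rightarrow> ('p \<Rightarrow> ereal) \<Rightarrow> 'p \<Rightarrow> int" where
  "ord_at \<Gamma> f x = (\<Sum>v\<in>tangents \<Gamma> x. outgoing_slope \<Gamma> f v)"

definition divisor :: "('p, 'e) metric_graph \<Rightarrow> ('p \<Rightarrow>\<^sub>0 int) \<Rightarrow> bool" where
  "divisor \<Gamma> D \<longleftrightarrow> Poly_Mapping.keys D \<subseteq> points \<Gamma>"

definition principal_divisor :: "('p, 'e) metric_graph \<Rightarrow> ('p \<Rightarrow> ereal) \<Rightarrow> ('p \<Rightarrow>\<^sub>0 int)" where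
  "principal_divisor \<Gamma> f =
     (\<Sum>x\<in>{x \<in> points \<Gamma>. ord_at \<Gamma> f x \<noteq> 0}. Poly_Mapping.single x (ord_at \<Gamma> f x))"

definition effective :: "('p \<Rightarrow>\<^sub>0 int) \<Rightarrow> bool" where
  "effective D \<longleftrightarrow> (\<forall>x. 0 \<le> Poly_Mapping.lookup D x)"

definition R :: "('p, 'e) metric_graph \<Rightarrow> ('p \<Rightarrow>\<^sub>0 int) \<Rightarrow> ('p \<Rightarrow> ereal) set" where
  "R \<Gamma> D = {f. rational_function \<Gamma> f \<and> effective (D + principal_divisor \<Gamma> f)}"

definition trop_add :: "('p \<Rightarrow> ereal) \<Rightarrow> ('p \<Rightarrow> ereal) \<Rightarrow> 'p \<Rightarrow> ereal" (infixl "\<oplus>\<^sub>t" 65) where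
  "(f \<oplus>\<^sub>t g) x = max (f x) (g x)"

definition trop_smult :: "real \<Rightarrow> ('p \<Rightarrow> ereal) \<Rightarrow> 'p \<Rightarrow> ereal" (infixr "\<odot>\<^sub>t" 70) where
  "(a \<odot>\<^sub>t f) x = ereal a + f x"

text \<open>
  The sums defining \<open>ord_at\<close> and \<open>principal_divisor\<close> are finite, so that the coefficients of
  \<open>principal_divisor \<Gamma> f\<close> are the orders of \<open>f\<close>.
\<close>

lemma finite_tangents:
  assumes "tropical_curve \<Gamma>"
  shows "finite (tangents \<Gamma> x)"
proof -
  let ?I = "SIGMA e:edges \<Gamma>. {0<..<elen \<Gamma> e}"
  let ?E = "(\<lambda>e. (e, 0)) ` edges \<Gamma> \<union> (\<lambda>e. (e, elen \<Gamma> e)) ` edges \<Gamma>"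
  let ?J = "{p \<in> ?I. (case p of (e, t) \<Rightarrow> chart \<Gamma> e t) = x}"
  have inj: "inj_on (\<lambda>(e, t). chart \<Gamma> e t) ?I"
    using assms by (simp add: tropical_curve_def bij_betw_def)
  have "finite ?J"
  proof (cases "?J = {}")
    case False
    then obtain p where p: "p \<in> ?J" by blast
    have "?J \<subseteq> {p}"
      using inj_onD[OF inj] p by fastforce
    then show ?thesis
      using finite_subset by blast
  next
    case True
    then show ?thesis by (simp only: finite.emptyI)
  qed
  moreover have "finite ?E"
    using assms by (simp add: tropical_curve_def)
  ultimately have fin: "finite (?J \<union> ?E)" by blast
  have "tangents \<Gamma> x \<subseteq> (\<lambda>((e, t), d). (e, t, d)) ` ((?J \<union> ?E) \<times> {Forward, Backward})"
  proof
    fix v assume v: "v \<in> tangents \<Gamma> x"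
    obtain e t d where [simp]: "v = (e, t, d)" by (cases v)
    have "e \<in> edges \<Gamma>" "0 \<le> t" "t \<le> elen \<Gamma> e" "chart \<Gamma> e t = x"
      using v by (auto simp: tangents_def)
    then have "(e, t) \<in> ?J \<union> ?E"
      by (cases "t = 0"; cases "t = elen \<Gamma> e") auto
    moreover have "d \<in> {Forward, Backward}"
      by (cases d) auto
    ultimately have "((e, t), d) \<in> (?J \<union> ?E) \<times> {Forward, Backward}"
      by blast
    then show "v \<in> (\<lambda>((e, t), d). (e, t, d)) ` ((?J \<union> ?E) \<times> {Forward, Backward})"
      by (rule rev_image_eqI) simp
  qed
  then show ?thesis
    by (rule finite_subset) (use fin in simp)
qed

lemma affine_slope_unique:
  fixes a b :: ereal and c c' m m' :: real
  assumes "a < b"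
    and "\<forall>s\<in>{a<..<b}. ereal (c + m * real_of_ereal s) = ereal (c' + m' * real_of_ereal s)"
  shows "m = m'"
proof -
  obtain p where p: "a < ereal p" "ereal p < b"
    using ereal_dense2[OF assms(1)] by blast
  obtain q where q: "ereal p < ereal q" "ereal q < b"
    using ereal_dense2[OF p(2)] by blast
  have "c + m * p = c' + m' * p"
    using assms(2) p by force
  moreover have "c + m * q = c' + m' * q"
    using assms(2) p q by (smt (verit) greaterThanLessThan_iff less_trans ereal.inject real_of_ereal.simps(1))
  ultimately have "(m - m') * (q - p) = 0"
    by (simp add: algebra_simps)
  then show ?thesis
    using q(1) by simp
qed

lemma slope_along_at_right:
  fixes t b :: ereal and c :: real
  assumes "t < b"
    and h: "\<forall>s\<in>{t<..<b}. h s = ereal (c + of_int m * real_of_ereal s)"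
  shows "slope_along h (at_right t) = m"
  unfolding slope_along_def
proof (rule the_equality)
  show "\<exists>c::real. \<forall>\<^sub>F s in at_right t. h s = ereal (c + of_int m * real_of_ereal s)"
    using assms unfolding eventually_at_right[OF assms(1)] by (metis greaterThanLessThan_iff)
next
  fix n assume "\<exists>c::real. \<forall>\<^sub>F s in at_right t. h s = ereal (c + of_int n * real_of_ereal s)"
  then obtain c' b' where b': "t < b'"
    "\<And>s. t < s \<Longrightarrow> s < b' \<Longrightarrow> h s = ereal (c' + of_int n * real_of_ereal s)"
    by (auto simp: eventually_at_right[OF assms(1)])
  have "\<forall>s\<in>{t<..<min b b'}. ereal (c' + of_int n * real_of_ereal s) = ereal (c + of_int m * real_of_ereal s)"
  proof
    fix s assume "s \<in> {t<..<min b b'}"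
    then have "h s = ereal (c' + of_int n * real_of_ereal s)"
      and "h s = ereal (c + of_int m * real_of_ereal s)"
      using b'(2)[of s] bspec[OF h, of s] by simp_all
    then show "ereal (c' + of_int n * real_of_ereal s) = ereal (c + of_int m * real_of_ereal s)"
      by simp
  qed
  moreover have "t < min b b'"
    using assms(1) b'(1) by simp
  ultimately have "(of_int n :: real) = of_int m"
    using affine_slope_unique by blast
  then show "n = m" by simp
qed

lemma slope_along_at_left:
  fixes t a :: ereal and c :: real
  assumes "a < t"
    and h: "\<forall>s\<in>{a<..<t}. h s = ereal (c + of_int m * real_of_ereal s)"
  shows "slope_along h (at_left t) = m"
  unfolding slope_along_def
proof (rule the_equality)
  show "\<exists>c::real. \<forall>\<^sub>F s in at_left t. h s = ereal (c + of_int m * real_of_ereal s)"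
    using assms unfolding eventually_at_left[OF assms(1)] by (metis greaterThanLessThan_iff)
next
  fix n assume "\<exists>c::real. \<forall>\<^sub>F s in at_left t. h s = ereal (c + of_int n * real_of_ereal s)"
  then obtain c' a' where a': "a' < t"
    "\<And>s. a' < s \<Longrightarrow> s < t \<Longrightarrow> h s = ereal (c' + of_int n * real_of_ereal s)"
    by (auto simp: eventually_at_left[OF assms(1)])
  have "\<forall>s\<in>{max a a'<..<t}. ereal (c' + of_int n * real_of_ereal s) = ereal (c + of_int m * real_of_ereal s)"
  proof
    fix s assume "s \<in> {max a a'<..<t}"
    then have "h s = ereal (c' + of_int n * real_of_ereal s)"
      and "h s = ereal (c + of_int m * real_of_ereal s)"
      using a'(2)[of s] bspec[OF h, of s] by simp_all
    then show "ereal (c' + of_int n * real_of_ereal s) = ereal (c + of_int m * real_of_ereal s)"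
      by simp
  qed
  moreover have "max a a' < t"
    using assms(1) a'(1) by simp
  ultimately have "(of_int n :: real) = of_int m"
    using affine_slope_unique by blast
  then show "n = m" by simp
qed

lemma tangents_interior:
  assumes \<Gamma>: "tropical_curve \<Gamma>" and e: "e \<in> edges \<Gamma>" "0 < t" "t < elen \<Gamma> e"
  shows "tangents \<Gamma> (chart \<Gamma> e t) = {(e, t, Forward), (e, t, Backward)}"
proof -
  let ?I = "SIGMA e:edges \<Gamma>. {0<..<elen \<Gamma> e}"
  have bij: "bij_betw (\<lambda>(e, t). chart \<Gamma> e t) ?I (points \<Gamma> - verts \<Gamma>)"
    using \<Gamma> by (simp add: tropical_curve_def)
  have "(\<lambda>(e, t). chart \<Gamma> e t) (e, t) \<in> points \<Gamma> - verts \<Gamma>"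
    by (rule bij_betwE[OF bij, rule_format]) (use e in auto)
  then have nv: "chart \<Gamma> e t \<notin> verts \<Gamma>"
    by simp
  have "e' = e \<and> t' = t"
    if "e' \<in> edges \<Gamma>" "0 \<le> t'" "t' \<le> elen \<Gamma> e'" "chart \<Gamma> e' t' = chart \<Gamma> e t" for e' t'
  proof -
    have "chart \<Gamma> e' 0 \<in> verts \<Gamma>" "chart \<Gamma> e' (elen \<Gamma> e') \<in> verts \<Gamma>"
      using \<Gamma> that(1) by (auto simp: tropical_curve_def)
    then have "t' \<noteq> 0" "t' \<noteq> elen \<Gamma> e'"
      using nv that(4) by auto
    then have "0 < t'" "t' < elen \<Gamma> e'"
      using that by auto
    then have "(e', t') = (e, t)"
      using inj_onD[OF bij_betw_imp_inj_on[OF bij], of "(e', t')" "(e, t)"] that e by auto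
    then show ?thesis by simp
  qed
  then show ?thesis
    using e unfolding tangents_def by (auto dest: less_imp_le)
qed

lemma finite_ord_support:
  assumes \<Gamma>: "tropical_curve \<Gamma>" and f: "rational_function \<Gamma> f"
  shows "finite {x \<in> points \<Gamma>. ord_at \<Gamma> f x \<noteq> 0}"
proof -
  have bij: "bij_betw (\<lambda>(e, t). chart \<Gamma> e t) (SIGMA e:edges \<Gamma>. {0<..<elen \<Gamma> e})
       (points \<Gamma> - verts \<Gamma>)" and fin: "finite (verts \<Gamma>)" "finite (edges \<Gamma>)"
    using \<Gamma> by (simp_all add: tropical_curve_def)
  obtain B where B: "\<And>e. e \<in> edges \<Gamma> \<Longrightarrow> finite (B e)"
    "\<And>e a b. e \<in> edges \<Gamma> \<Longrightarrow> {a<..<b} \<subseteq> {0<..<elen \<Gamma> e} - B e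
       \<Longrightarrow> affine_between (\<lambda>s. f (chart \<Gamma> e s)) a b"
    using f unfolding rational_function_def piecewise_linear_def by metis
  have "{x \<in> points \<Gamma>. ord_at \<Gamma> f x \<noteq> 0} \<subseteq> verts \<Gamma> \<union> (\<Union>e\<in>edges \<Gamma>. chart \<Gamma> e ` B e)"
  proof (rule subsetI, rule ccontr)
    fix x assume x: "x \<in> {x \<in> points \<Gamma>. ord_at \<Gamma> f x \<noteq> 0}"
      and n: "x \<notin> verts \<Gamma> \<union> (\<Union>e\<in>edges \<Gamma>. chart \<Gamma> e ` B e)"
    then have "x \<in> (\<lambda>(e, t). chart \<Gamma> e t) ` (SIGMA e:edges \<Gamma>. {0<..<elen \<Gamma> e})"
      using bij by (auto simp: bij_betw_def)
    then obtain e t where e: "e \<in> edges \<Gamma>" "0 < t" "t < elen \<Gamma> e" "x = chart \<Gamma> e t"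
      by auto
    let ?S = "{0<..<elen \<Gamma> e} - B e"
    have S: "open ?S" "t \<in> ?S"
      using B(1)[OF e(1)] e n by (auto intro!: open_Diff finite_imp_closed)
    obtain a where a: "a < t" "{a<..t} \<subseteq> ?S"
      using open_left[OF S e(2)] by blast
    obtain b where b: "t < b" "{t..<b} \<subseteq> ?S"
      using open_right[OF S e(3)] by blast
    have "{a<..<b} \<subseteq> {a<..t} \<union> {t..<b}"
      by auto
    then have "affine_between (\<lambda>s. f (chart \<Gamma> e s)) a b"
      using a b by (intro B(2)[OF e(1)]) blast
    then obtain m :: int and c :: real where
      "\<forall>s\<in>{a<..<b}. f (chart \<Gamma> e s) = ereal (c + of_int m * real_of_ereal s)"
      unfolding affine_between_def by blast
    then have "slope_along (\<lambda>s. f (chart \<Gamma> e s)) (at_right t) = m"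
      "slope_along (\<lambda>s. f (chart \<Gamma> e s)) (at_left t) = m"
      using a b by (auto intro!: slope_along_at_right[of t b] slope_along_at_left[of a t])
    then have "ord_at \<Gamma> f x = 0"
      unfolding ord_at_def e(4) tangents_interior[OF \<Gamma> e(1-3)] by simp
    then show False
      using x by simp
  qed
  then show ?thesis
    by (rule finite_subset) (use B fin in auto)
qed

lemma lookup_principal_divisor:
  assumes "tropical_curve \<Gamma>" and "rational_function \<Gamma> f" and "x \<in> points \<Gamma>"
  shows "Poly_Mapping.lookup (principal_divisor \<Gamma> f) x = ord_at \<Gamma> f x"
  using finite_ord_support[OF assms(1,2)] assms(3)
  by (simp add: principal_divisor_def lookup_sum lookup_single when_def sum.delta')

end

theory Submission
  imports Defs
begin

text \<open>
  Along an edge the difference of two rational functions \<open>f\<close> and \<open>g\<close> changes sign only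
  finitely often, so \<open>f \<oplus> g\<close> coincides with one of them on each piece of a common
  subdivision. If \<open>f x \<ge> g x\<close> and these values are finite, then \<open>f \<oplus> g\<close> dominates \<open>f\<close>
  and agrees with it at \<open>x\<close>, so all its outgoing slopes are at least those of \<open>f\<close>. A point at
  infinity has a single tangent direction, in which \<open>f \<oplus> g\<close> coincides with \<open>f\<close> or \<open>g\<close>.
\<close>

section \<open>Sign changes of the difference of two piecewise linear functions\<close>

text \<open>Affine functions of equal slope differ by a constant, and those of distinct slopes cross
  at one parameter only, so \<open>B\<close> can be taken empty or a singleton. Quantifying over all
  subintervals that avoid a finite set gives the same form as
  \<open>piecewise_linear\<close>.\<close>

lemma affine_comparable:
  assumes f: "affine_between f p q" and g: "affine_between g p q"
  shows "\<exists>B. finite B \<and> (\<forall>a b. {a<..<b} \<subseteq> {p<..<q} - B \<longrightarrow>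
           (\<forall>s\<in>{a<..<b}. f s \<le> g s) \<or> (\<forall>s\<in>{a<..<b}. g s \<le> f s))"
proof -
  obtain m :: int and c :: real where
    f: "\<And>s. s \<in> {p<..<q} \<Longrightarrow> f s = ereal (c + of_int m * real_of_ereal s)"
    using f unfolding affine_between_def by blast
  obtain n :: int and d :: real where
    g: "\<And>s. s \<in> {p<..<q} \<Longrightarrow> g s = ereal (d + of_int n * real_of_ereal s)"
    using g unfolding affine_between_def by blast
  show ?thesis
  proof (cases "m = n")
    case True
    then show ?thesis
      by (intro exI[of _ "{}"]) (use f g in \<open>auto simp: subset_iff\<close>)
  next
    case False
    \<comment> \<open>\<open>z\<close> is the parameter where the two affine formulas agree. It may
      lie outside \<open>{p<..<q}\<close>, in which case removing it does no harm.\<close>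
    define z where "z = (d - c) / (of_int m - of_int n)"
    have z: "(c + of_int m * r) - (d + of_int n * r) = (of_int m - of_int n) * (r - z)" for r :: real
      using False by (simp add: z_def field_simps)
    have "(\<forall>s\<in>{a<..<b}. f s \<le> g s) \<or> (\<forall>s\<in>{a<..<b}. g s \<le> f s)"
      if ab: "{a<..<b} \<subseteq> {p<..<q} - {ereal z}" for a b
    proof -
      have le: "f s \<le> g s \<longleftrightarrow> (of_int m - of_int n) * (real_of_ereal s - z) \<le> 0"
        "g s \<le> f s \<longleftrightarrow> 0 \<le> (of_int m - of_int n) * (real_of_ereal s - z)"
        if "s \<in> {a<..<b}" for s
      proof -
        have s: "s \<in> {p<..<q}"
          using that ab by blast
        show "f s \<le> g s \<longleftrightarrow> (of_int m - of_int n) * (real_of_ereal s - z) \<le> 0"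
          "g s \<le> f s \<longleftrightarrow> 0 \<le> (of_int m - of_int n) * (real_of_ereal s - z)"
          unfolding f[OF s] g[OF s] z[symmetric] by auto
      qed
      \<comment> \<open>An open interval that misses \<open>z\<close> lies on one side of it, where
        the product in \<open>le\<close> has constant sign.\<close>
      have "b \<le> ereal z \<or> ereal z \<le> a"
        using ab by (auto simp: subset_iff not_le)
      then have "(\<forall>s\<in>{a<..<b}. real_of_ereal s \<le> z) \<or> (\<forall>s\<in>{a<..<b}. z \<le> real_of_ereal s)"
      proof
        assume "b \<le> ereal z"
        then have "real_of_ereal s \<le> z" if "s \<in> {a<..<b}" for s
          using that by (cases s) (auto dest: less_le_trans)
        then show ?thesis by blast
      next
        assume "ereal z \<le> a"
        then have "z \<le> real_of_ereal s" if "s \<in> {a<..<b}" for s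
          using that by (cases s) (auto dest: le_less_trans)
        then show ?thesis by blast
      qed
      moreover have "m < n \<or> n < m"
        using False by auto
      ultimately show ?thesis
        by (auto simp: le mult_le_0_iff zero_le_mult_iff)
    qed
    then show ?thesis
      by (intro exI[of _ "{ereal z}"]) blast
  qed
qed

text \<open>Induction on the number of break points. The endpoints are generalised because a break
  point inside the interval splits it into two intervals, and the induction hypothesis is applied to
  each. The resulting \<open>B'\<close> collects the crossings as well as the break points.\<close>

lemma piecewise_affine_comparable:
  fixes p q :: ereal
  assumes "finite B"
    and "\<And>a b. {a<..<b} \<subseteq> {p<..<q} - B \<Longrightarrow> affine_between f a b"
    and "\<And>a b. {a<..<b} \<subseteq> {p<..<q} - B \<Longrightarrow> affine_between g a b"
  shows "\<exists>B'. finite B' \<and> (\<forall>a b. {a<..<b} \<subseteq> {p<..<q} - B' \<longrightarrow>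
           (\<forall>s\<in>{a<..<b}. f s \<le> g s) \<or> (\<forall>s\<in>{a<..<b}. g s \<le> f s))"
  using assms
proof (induction B arbitrary: p q rule: finite_induct)
  case empty
  then show ?case
    by (intro affine_comparable) auto
next
  case (insert x B)
  show ?case
  proof (cases "x \<in> {p<..<q}")
    case False
    then have "{p<..<q} - insert x B = {p<..<q} - B"
      by auto
    then show ?thesis
      using insert.IH[of p q] insert.prems by simp
  next
    case True
    \<comment> \<open>In each half \<open>x\<close> has become an endpoint, so only the points of
      \<open>B\<close> are left to remove.\<close>
    then have sub: "{p<..<x} - B \<subseteq> {p<..<q} - insert x B" "{x<..<q} - B \<subseteq> {p<..<q} - insert x B"
      by auto
    obtain B1 where B1: "finite B1" "\<And>a b. {a<..<b} \<subseteq> {p<..<x} - B1 \<Longrightarrow>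
        (\<forall>s\<in>{a<..<b}. f s \<le> g s) \<or> (\<forall>s\<in>{a<..<b}. g s \<le> f s)"
      using insert.IH[of p x, OF insert.prems[OF order_trans[OF _ sub(1)]]] by metis
    obtain B2 where B2: "finite B2" "\<And>a b. {a<..<b} \<subseteq> {x<..<q} - B2 \<Longrightarrow>
        (\<forall>s\<in>{a<..<b}. f s \<le> g s) \<or> (\<forall>s\<in>{a<..<b}. g s \<le> f s)"
      using insert.IH[of x q, OF insert.prems[OF order_trans[OF _ sub(2)]]] by metis
    have "(\<forall>s\<in>{a<..<b}. f s \<le> g s) \<or> (\<forall>s\<in>{a<..<b}. g s \<le> f s)"
      if ab: "{a<..<b} \<subseteq> {p<..<q} - insert x (B1 \<union> B2)" for a b
    proof -
      have "b \<le> x \<or> x \<le> a"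
        using ab by (auto simp: subset_iff not_le)
      then show ?thesis
      proof
        assume "b \<le> x"
        then have "{a<..<b} \<subseteq> {p<..<x} - B1"
          using ab by (auto simp: subset_iff)
        then show ?thesis
          by (rule B1(2))
      next
        assume "x \<le> a"
        then have "{a<..<b} \<subseteq> {x<..<q} - B2"
          using ab by (auto simp: subset_iff)
        then show ?thesis
          by (rule B2(2))
      qed
    qed
    then show ?thesis
      using B1(1) B2(1) by (intro exI[of _ "insert x (B1 \<union> B2)"]) blast
  qed
qed

text \<open>A larger set leaves fewer intervals to check, so each of the three properties survives
  when its finite set is enlarged to the union.\<close>

lemma common_subdivision:
  assumes f: "piecewise_linear \<Gamma> f" and g: "piecewise_linear \<Gamma> g" and e: "e \<in> edges \<Gamma>"
  obtains B where "finite B"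
    and "\<And>a b. {a<..<b} \<subseteq> {0<..<elen \<Gamma> e} - B \<Longrightarrow> affine_between (\<lambda>s. f (chart \<Gamma> e s)) a b"
    and "\<And>a b. {a<..<b} \<subseteq> {0<..<elen \<Gamma> e} - B \<Longrightarrow> affine_between (\<lambda>s. g (chart \<Gamma> e s)) a b"
    and "\<And>a b. {a<..<b} \<subseteq> {0<..<elen \<Gamma> e} - B \<Longrightarrow>
           (\<forall>s\<in>{a<..<b}. f (chart \<Gamma> e s) \<le> g (chart \<Gamma> e s)) \<or>
           (\<forall>s\<in>{a<..<b}. g (chart \<Gamma> e s) \<le> f (chart \<Gamma> e s))"
proof -
  obtain B1 where B1: "finite B1"
    "\<And>a b. {a<..<b} \<subseteq> {0<..<elen \<Gamma> e} - B1 \<Longrightarrow> affine_between (\<lambda>s. f (chart \<Gamma> e s)) a b"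
    using f e unfolding piecewise_linear_def by blast
  obtain B2 where B2: "finite B2"
    "\<And>a b. {a<..<b} \<subseteq> {0<..<elen \<Gamma> e} - B2 \<Longrightarrow> affine_between (\<lambda>s. g (chart \<Gamma> e s)) a b"
    using g e unfolding piecewise_linear_def by blast
  have "\<exists>B'. finite B' \<and> (\<forall>a b. {a<..<b} \<subseteq> {0<..<elen \<Gamma> e} - B' \<longrightarrow>
          (\<forall>s\<in>{a<..<b}. f (chart \<Gamma> e s) \<le> g (chart \<Gamma> e s)) \<or>
          (\<forall>s\<in>{a<..<b}. g (chart \<Gamma> e s) \<le> f (chart \<Gamma> e s)))"
    by (rule piecewise_affine_comparable[of "B1 \<union> B2"]) (use B1 B2 in blast)+
  then obtain B3 where B3: "finite B3" "\<And>a b. {a<..<b} \<subseteq> {0<..<elen \<Gamma> e} - B3 \<Longrightarrow>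
      (\<forall>s\<in>{a<..<b}. f (chart \<Gamma> e s) \<le> g (chart \<Gamma> e s)) \<or>
      (\<forall>s\<in>{a<..<b}. g (chart \<Gamma> e s) \<le> f (chart \<Gamma> e s))"
    by blast
  show thesis
    by (rule that[of "B1 \<union> B2 \<union> B3"]) (use B1 B2 B3 in blast)+
qed

section \<open>Rational functions under the tropical operations\<close>

lemma affine_between_cong:
  assumes "\<And>s. s \<in> {a<..<b} \<Longrightarrow> f s = g s"
  shows "affine_between f a b \<longleftrightarrow> affine_between g a b"
  using assms by (simp add: affine_between_def)

lemma piecewise_linear_trop_add:
  assumes "piecewise_linear \<Gamma> f" and "piecewise_linear \<Gamma> g"
  shows "piecewise_linear \<Gamma> (f \<oplus>\<^sub>t g)"
  unfolding piecewise_linear_def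
proof
  fix e assume e: "e \<in> edges \<Gamma>"
  obtain B where "finite B" and B:
    "\<And>a b. {a<..<b} \<subseteq> {0<..<elen \<Gamma> e} - B \<Longrightarrow> affine_between (\<lambda>s. f (chart \<Gamma> e s)) a b"
    "\<And>a b. {a<..<b} \<subseteq> {0<..<elen \<Gamma> e} - B \<Longrightarrow> affine_between (\<lambda>s. g (chart \<Gamma> e s)) a b"
    "\<And>a b. {a<..<b} \<subseteq> {0<..<elen \<Gamma> e} - B \<Longrightarrow>
       (\<forall>s\<in>{a<..<b}. f (chart \<Gamma> e s) \<le> g (chart \<Gamma> e s)) \<or>
       (\<forall>s\<in>{a<..<b}. g (chart \<Gamma> e s) \<le> f (chart \<Gamma> e s))"
    using common_subdivision[OF assms e] by blast
  have "affine_between (\<lambda>s. (f \<oplus>\<^sub>t g) (chart \<Gamma> e s)) a b"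
    if ab: "{a<..<b} \<subseteq> {0<..<elen \<Gamma> e} - B" for a b
    using B(3)[OF ab]
  proof
    assume "\<forall>s\<in>{a<..<b}. f (chart \<Gamma> e s) \<le> g (chart \<Gamma> e s)"
    then show ?thesis
      using B(2)[OF ab] by (subst affine_between_cong) (auto simp: trop_add_def max_absorb2)
  next
    assume "\<forall>s\<in>{a<..<b}. g (chart \<Gamma> e s) \<le> f (chart \<Gamma> e s)"
    then show ?thesis
      using B(1)[OF ab] by (subst affine_between_cong) (auto simp: trop_add_def max_absorb1)
  qed
  then show "\<exists>B. finite B \<and> (\<forall>a b. {a<..<b} \<subseteq> {0<..<elen \<Gamma> e} - B \<longrightarrow>
      affine_between (\<lambda>s. (f \<oplus>\<^sub>t g) (chart \<Gamma> e s)) a b)"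
    using \<open>finite B\<close> by blast
qed

lemma rational_function_trop_add:
  assumes "rational_function \<Gamma> f" and "rational_function \<Gamma> g"
  shows "rational_function \<Gamma> (f \<oplus>\<^sub>t g)"
proof -
  have "continuous_map (topol \<Gamma>) euclidean (f \<oplus>\<^sub>t g)"
    \<comment> \<open>Continuity is read as convergence at each point, so that the limit rule for
      maxima applies.\<close>
    using assms unfolding rational_function_def continuous_map_atin limitin_canonical_iff
    by (auto simp: trop_add_def [abs_def] intro!: tendsto_max)
  moreover have "\<bar>(f \<oplus>\<^sub>t g) x\<bar> \<noteq> \<infinity>" if "x \<in> points \<Gamma> - points_at_infinity \<Gamma>" for x
    using assms that by (auto simp: rational_function_def trop_add_def max_def)
  ultimately show ?thesis
    using assms by (simp add: rational_function_def piecewise_linear_trop_add)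
qed

lemma rational_function_trop_smult:
  assumes "rational_function \<Gamma> f"
  shows "rational_function \<Gamma> (a \<odot>\<^sub>t f)"
proof -
  have "continuous_map (topol \<Gamma>) euclidean (a \<odot>\<^sub>t f)"
    \<comment> \<open>One summand is a finite constant, so no limit has the form \<infinity> -
      \<infinity>, even where \<open>f\<close> is infinite.\<close>
    using assms unfolding rational_function_def continuous_map_atin limitin_canonical_iff
    by (auto simp: trop_smult_def [abs_def] intro!: tendsto_add_ereal_general)
  moreover have "affine_between (\<lambda>s. (a \<odot>\<^sub>t f) (chart \<Gamma> e s)) p q"
    if "affine_between (\<lambda>s. f (chart \<Gamma> e s)) p q" for e p q
  proof -
    obtain m :: int and c :: real where
      "\<forall>s\<in>{p<..<q}. f (chart \<Gamma> e s) = ereal (c + of_int m * real_of_ereal s)"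
      using \<open>affine_between (\<lambda>s. f (chart \<Gamma> e s)) p q\<close> unfolding affine_between_def by blast
    then show ?thesis
      unfolding affine_between_def trop_smult_def
      by (intro exI[of _ m] exI[of _ "a + c"]) (simp add: add.assoc)
  qed
  then have "piecewise_linear \<Gamma> (a \<odot>\<^sub>t f)"
    using assms unfolding rational_function_def piecewise_linear_def by meson
  moreover have "\<bar>(a \<odot>\<^sub>t f) x\<bar> \<noteq> \<infinity>" if "x \<in> points \<Gamma> - points_at_infinity \<Gamma>" for x
  proof -
    have "\<bar>f x\<bar> \<noteq> \<infinity>"
      using assms that by (simp add: rational_function_def)
    then show ?thesis
      by (cases "f x") (simp_all add: trop_smult_def)
  qed
  ultimately show ?thesis
    by (simp add: rational_function_def)
qed

section \<open>Invariance of slopes and orders\<close>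

text \<open>The shift by \<open>a\<close> is absorbed into the existentially quantified constant
  \<open>c\<close>, so the same integers \<open>m\<close> satisfy the condition under
  \<open>THE\<close>.\<close>

lemma slope_along_add_const: "slope_along (\<lambda>s. ereal a + h s) F = slope_along h F"
proof -
  \<comment> \<open>For infinite \<open>y\<close> both sides are false, so the equivalence needs no
    case distinction where it is used.\<close>
  have eq: "ereal a + y = ereal (c + r) \<longleftrightarrow> y = ereal (c - a + r)" for y c r
    by (cases y) auto
  have "(\<exists>c::real. \<forall>\<^sub>F s in F. h s = ereal (c - a + of_int m * real_of_ereal s)) \<longleftrightarrow>
        (\<exists>c::real. \<forall>\<^sub>F s in F. h s = ereal (c + of_int m * real_of_ereal s))" for m :: int
    by (metis add_diff_cancel)
  then show ?thesis
    by (simp add: slope_along_def eq)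
qed

lemma ord_at_trop_smult: "ord_at \<Gamma> (a \<odot>\<^sub>t f) x = ord_at \<Gamma> f x"
proof -
  have "outgoing_slope \<Gamma> (a \<odot>\<^sub>t f) v = outgoing_slope \<Gamma> f v" for v
    by (cases "(\<Gamma>, f, v)" rule: outgoing_slope.cases) (simp_all add: trop_smult_def slope_along_add_const)
  then show ?thesis
    by (simp add: ord_at_def)
qed

text \<open>A slope depends only on the germ along the filter. At infinity this identifies the slope
  of a maximum with that of the function attaining it.\<close>

lemma slope_along_cong:
  assumes "\<forall>\<^sub>F s in F. h s = h' s"
  shows "slope_along h F = slope_along h' F"
proof -
  have "(\<forall>\<^sub>F s in F. h s = ereal (c + of_int m * real_of_ereal s)) \<longleftrightarrow>
        (\<forall>\<^sub>F s in F. h' s = ereal (c + of_int m * real_of_ereal s))" for c :: real and m :: int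
    by (rule eventually_cong[OF assms]) simp
  then show ?thesis
    by (simp add: slope_along_def)
qed

section \<open>Slopes at finite parameters\<close>

lemma right_piece:
  fixes t L :: ereal
  assumes "finite B" "0 \<le> t" "t < L"
  obtains b where "t < b" "b \<le> L" "{t<..<b} \<subseteq> {0<..<L} - B"
proof -
  \<comment> \<open>The parameter \<open>t\<close> may itself be a break point, so it is taken out
    of \<open>B\<close> first. The open interval starting at \<open>t\<close> omits it
    anyway.\<close>
  have "open (- (B - {t}))" "t \<in> - (B - {t})"
    using assms(1) by (auto intro!: open_Compl finite_imp_closed simp del: Compl_Diff_eq)
  then obtain b where b: "t < b" "{t..<b} \<subseteq> - (B - {t})"
    using open_right[OF _ _ assms(3)] by blast
  have "{t<..<min b L} \<subseteq> {0<..<L} - B"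
  proof
    fix s assume "s \<in> {t<..<min b L}"
    then have "t < s" "s \<in> {t..<b}" "s < L"
      by auto
    then show "s \<in> {0<..<L} - B"
      using b(2) le_less_trans[OF assms(2), of s] by auto
  qed
  then show thesis
    using assms(3) b(1) that[of "min b L"] by simp
qed

text \<open>Mirror image of \<open>right_piece\<close>. The case \<open>t = L = \<infinity>\<close>
  is included and yields the unbounded last piece of an infinite edge.\<close>

lemma left_piece:
  fixes t L :: ereal
  assumes "finite B" "0 < t" "t \<le> L"
  obtains a where "0 \<le> a" "a < t" "{a<..<t} \<subseteq> {0<..<L} - B"
proof -
  have "open (- (B - {t}))" "t \<in> - (B - {t})"
    using assms(1) by (auto intro!: open_Compl finite_imp_closed simp del: Compl_Diff_eq)
  then obtain a where a: "a < t" "{a<..t} \<subseteq> - (B - {t})"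
    using open_left[OF _ _ assms(2)] by blast
  show thesis
    by (rule that[of "max a 0"]) (use assms(2,3) a in \<open>auto simp: subset_iff\<close>)
qed

text \<open>As \<open>real_of_ereal\<close> is continuous at a finite parameter, an affine formula
  valid on one side passes to the limit. For a continuous function this extends the formula to the
  endpoint of the piece.\<close>

lemma limit_of_affine:
  assumes F: "F \<noteq> bot" "F \<le> at (ereal r)"
    and h: "(h \<longlongrightarrow> y) F" "\<forall>\<^sub>F s in F. h s = ereal (c + m * real_of_ereal s)"
  shows "y = ereal (c + m * r)"
proof -
  have "(real_of_ereal \<longlongrightarrow> r) F"
    by (rule lim_real_of_ereal[OF tendsto_mono[OF F(2) tendsto_ident_at]])
  then have "((\<lambda>s. ereal (c + m * real_of_ereal s)) \<longlongrightarrow> ereal (c + m * r)) F"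
    by (intro tendsto_ereal tendsto_add tendsto_mult tendsto_const)
  moreover have "((\<lambda>s. ereal (c + m * real_of_ereal s)) \<longlongrightarrow> y) F"
    using h(1) by (simp add: tendsto_cong[OF h(2)])
  ultimately show ?thesis
    using F(1) tendsto_unique by blast
qed

text \<open>By continuity both affine formulas hold at \<open>r\<close> as well, where they agree.
  The inequality at a single later parameter then orders the slopes.\<close>

lemma slope_right_mono:
  assumes t: "ereal r < b" and sub: "{ereal r..<b} \<subseteq> S"
    and f: "affine_between f (ereal r) b" "continuous_on S f"
    and h: "affine_between h (ereal r) b" "continuous_on S h"
    and le: "\<And>s. s \<in> S \<Longrightarrow> f s \<le> h s" and eq: "f (ereal r) = h (ereal r)"
  shows "slope_along f (at_right (ereal r)) \<le> slope_along h (at_right (ereal r))"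
proof -
  let ?F = "at_right (ereal r)"
  obtain m :: int and c :: real where
    f': "\<forall>s\<in>{ereal r<..<b}. f s = ereal (c + of_int m * real_of_ereal s)"
    using f(1) unfolding affine_between_def by blast
  obtain n :: int and d :: real where
    h': "\<forall>s\<in>{ereal r<..<b}. h s = ereal (d + of_int n * real_of_ereal s)"
    using h(1) unfolding affine_between_def by blast
  have ne: "?F \<noteq> bot"
    unfolding trivial_limit_def eventually_at_right[OF t] using dense by blast
  \<comment> \<open>This makes the one-sided filter finer than the filter within \<open>S\<close>,
    so continuity on \<open>S\<close> gives one-sided limits.\<close>
  have "?F = at (ereal r) within {ereal r<..<b}"
    by (rule at_within_nhd[of _ "{..<b}"]) (use t in auto)
  also have "\<dots> \<le> at (ereal r) within S"
    by (rule at_le, rule order_trans[OF _ sub]) auto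
  finally have F: "?F \<le> at (ereal r) within S" .
  have r: "ereal r \<in> S"
    using t sub by auto
  have "(f \<longlongrightarrow> f (ereal r)) ?F" "(h \<longlongrightarrow> h (ereal r)) ?F"
    using f(2) h(2) r F by (auto simp: continuous_on_def intro: tendsto_mono)
  moreover have "\<forall>\<^sub>F s in ?F. f s = ereal (c + of_int m * real_of_ereal s)"
    "\<forall>\<^sub>F s in ?F. h s = ereal (d + of_int n * real_of_ereal s)"
    using t f' h' unfolding eventually_at_right[OF t] by auto
  moreover have "?F \<le> at (ereal r)"
    by (rule at_le) simp
  ultimately have "f (ereal r) = ereal (c + of_int m * r)" "h (ereal r) = ereal (d + of_int n * r)"
    using limit_of_affine[OF ne] by blast+
  then have cd: "c + of_int m * r = d + of_int n * r"
    using eq by simp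
  obtain q where q: "ereal r < ereal q" "ereal q < b"
    using ereal_dense2[OF t] by blast
  then have "f (ereal q) \<le> h (ereal q)"
    using sub by (intro le) auto
  then have "c + of_int m * q \<le> d + of_int n * q"
    using f' h' q by simp
  then have "0 \<le> (of_int n - of_int m) * (q - r)"
    using cd by (simp add: algebra_simps)
  then have "m \<le> n"
    using q(1) by (simp add: zero_le_mult_iff)
  then show ?thesis
    using slope_along_at_right[OF t f'] slope_along_at_right[OF t h'] by simp
qed

text \<open>Comparing at a parameter before \<open>r\<close> reverses the inequality of slopes. The
  minus sign of \<open>outgoing_slope\<close> in the direction \<open>Backward\<close> reverses it
  again.\<close>

lemma slope_left_antimono:
  assumes t: "a < ereal r" and sub: "{a<..ereal r} \<subseteq> S"
    and f: "affine_between f a (ereal r)" "continuous_on S f"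
    and h: "affine_between h a (ereal r)" "continuous_on S h"
    and le: "\<And>s. s \<in> S \<Longrightarrow> f s \<le> h s" and eq: "f (ereal r) = h (ereal r)"
  shows "slope_along h (at_left (ereal r)) \<le> slope_along f (at_left (ereal r))"
proof -
  let ?F = "at_left (ereal r)"
  obtain m :: int and c :: real where
    f': "\<forall>s\<in>{a<..<ereal r}. f s = ereal (c + of_int m * real_of_ereal s)"
    using f(1) unfolding affine_between_def by blast
  obtain n :: int and d :: real where
    h': "\<forall>s\<in>{a<..<ereal r}. h s = ereal (d + of_int n * real_of_ereal s)"
    using h(1) unfolding affine_between_def by blast
  have ne: "?F \<noteq> bot"
    unfolding trivial_limit_def eventually_at_left[OF t] using dense by blast
  have "?F = at (ereal r) within {a<..<ereal r}"
    by (rule at_within_nhd[of _ "{a<..}"]) (use t in auto)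
  also have "\<dots> \<le> at (ereal r) within S"
    by (rule at_le, rule order_trans[OF _ sub]) auto
  finally have F: "?F \<le> at (ereal r) within S" .
  have r: "ereal r \<in> S"
    using t sub by auto
  have "(f \<longlongrightarrow> f (ereal r)) ?F" "(h \<longlongrightarrow> h (ereal r)) ?F"
    using f(2) h(2) r F by (auto simp: continuous_on_def intro: tendsto_mono)
  moreover have "\<forall>\<^sub>F s in ?F. f s = ereal (c + of_int m * real_of_ereal s)"
    "\<forall>\<^sub>F s in ?F. h s = ereal (d + of_int n * real_of_ereal s)"
    using t f' h' unfolding eventually_at_left[OF t] by auto
  moreover have "?F \<le> at (ereal r)"
    by (rule at_le) simp
  ultimately have "f (ereal r) = ereal (c + of_int m * r)" "h (ereal r) = ereal (d + of_int n * r)"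
    using limit_of_affine[OF ne] by blast+
  then have cd: "c + of_int m * r = d + of_int n * r"
    using eq by simp
  obtain q where q: "a < ereal q" "ereal q < ereal r"
    using ereal_dense2[OF t] by blast
  then have "f (ereal q) \<le> h (ereal q)"
    using sub by (intro le) auto
  then have "c + of_int m * q \<le> d + of_int n * q"
    using f' h' q by simp
  then have "0 \<le> (of_int m - of_int n) * (r - q)"
    using cd by (simp add: algebra_simps)
  then have "n \<le> m"
    using q(2) by (simp add: zero_le_mult_iff)
  then show ?thesis
    using slope_along_at_left[OF t f'] slope_along_at_left[OF t h'] by simp
qed

lemma continuous_on_edge:
  assumes "tropical_curve \<Gamma>" and "rational_function \<Gamma> f" and "e \<in> edges \<Gamma>"
  shows "continuous_on {0..elen \<Gamma> e} (\<lambda>s. f (chart \<Gamma> e s))"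
proof -
  have "continuous_map (top_of_set {0..elen \<Gamma> e}) euclidean (f \<circ> chart \<Gamma> e)"
    using assms unfolding tropical_curve_def rational_function_def
    by (blast intro: continuous_map_compose)
  then show ?thesis
    by (simp add: o_def)
qed

lemma chart_in_points:
  assumes "tropical_curve \<Gamma>" and "e \<in> edges \<Gamma>" and "t \<in> {0..elen \<Gamma> e}"
  shows "chart \<Gamma> e t \<in> points \<Gamma>"
proof -
  have "continuous_map (top_of_set {0..elen \<Gamma> e}) (topol \<Gamma>) (chart \<Gamma> e)"
    using assms by (simp add: tropical_curve_def)
  then show ?thesis
    using assms(3) by (auto simp: continuous_map_def)
qed

text \<open>The sums run over the same tangents, so they are compared term by term through the
  one-sided slope inequalities.\<close>

lemma ord_at_mono:
  assumes \<Gamma>: "tropical_curve \<Gamma>"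
    and f: "rational_function \<Gamma> f" and h: "rational_function \<Gamma> h"
    and le: "\<And>y. y \<in> points \<Gamma> \<Longrightarrow> f y \<le> h y"
    and x: "x \<notin> points_at_infinity \<Gamma>" "f x = h x"
  shows "ord_at \<Gamma> f x \<le> ord_at \<Gamma> h x"
  unfolding ord_at_def
proof (rule sum_mono)
  fix v assume v: "v \<in> tangents \<Gamma> x"
  obtain e t d where [simp]: "v = (e, t, d)" by (cases v)
  have e: "e \<in> edges \<Gamma>" "0 \<le> t" "t \<le> elen \<Gamma> e" "chart \<Gamma> e t = x"
    using v by (auto simp: tangents_def)
  \<comment> \<open>A parameter \<infinity> would force the edge to have infinite length and make
    \<open>x\<close> its point at infinity.\<close>
  have "t \<noteq> \<infinity>"
    using e x(1) by (auto simp: points_at_infinity_def)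
  then obtain r where r: "t = ereal r"
    using e(2) by (cases t) auto
  let ?S = "{0..elen \<Gamma> e}"
  note cont = continuous_on_edge[OF \<Gamma> f e(1)] continuous_on_edge[OF \<Gamma> h e(1)]
  have le': "f (chart \<Gamma> e s) \<le> h (chart \<Gamma> e s)" if "s \<in> ?S" for s
    using le chart_in_points[OF \<Gamma> e(1) that] by blast
  have eq: "f (chart \<Gamma> e (ereal r)) = h (chart \<Gamma> e (ereal r))"
    using e(4) x(2) r by simp
  have pl: "piecewise_linear \<Gamma> f" "piecewise_linear \<Gamma> h"
    using f h by (simp_all add: rational_function_def)
  obtain B where "finite B" and B:
    "\<And>a b. {a<..<b} \<subseteq> {0<..<elen \<Gamma> e} - B \<Longrightarrow> affine_between (\<lambda>s. f (chart \<Gamma> e s)) a b"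
    "\<And>a b. {a<..<b} \<subseteq> {0<..<elen \<Gamma> e} - B \<Longrightarrow> affine_between (\<lambda>s. h (chart \<Gamma> e s)) a b"
    "\<And>a b. {a<..<b} \<subseteq> {0<..<elen \<Gamma> e} - B \<Longrightarrow>
       (\<forall>s\<in>{a<..<b}. f (chart \<Gamma> e s) \<le> h (chart \<Gamma> e s)) \<or>
       (\<forall>s\<in>{a<..<b}. h (chart \<Gamma> e s) \<le> f (chart \<Gamma> e s))"
    using common_subdivision[OF pl e(1)] by blast
  show "outgoing_slope \<Gamma> f v \<le> outgoing_slope \<Gamma> h v"
  proof (cases d)
    case Forward
    then have "t < elen \<Gamma> e"
      using v by (auto simp: tangents_def)
    then obtain b where b: "t < b" "b \<le> elen \<Gamma> e" "{t<..<b} \<subseteq> {0<..<elen \<Gamma> e} - B"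
      using right_piece[OF \<open>finite B\<close> e(2)] by blast
    have "{ereal r..<b} \<subseteq> ?S"
      using b(2) e(2) unfolding r by (meson atLeastAtMost_iff atLeastLessThan_iff less_imp_le order_trans subsetI)
    then show ?thesis
      using slope_right_mono[OF _ _ B(1)[OF b(3), unfolded r] cont(1)
          B(2)[OF b(3), unfolded r] cont(2) le' eq] b(1)
      by (simp add: Forward r)
  next
    case Backward
    then have "0 < t"
      using v by (auto simp: tangents_def)
    then obtain a where a: "0 \<le> a" "a < t" "{a<..<t} \<subseteq> {0<..<elen \<Gamma> e} - B"
      using left_piece[OF \<open>finite B\<close> _ e(3)] by blast
    have "{a<..ereal r} \<subseteq> ?S"
      using a(1) e(3) unfolding r by (meson atLeastAtMost_iff greaterThanAtMost_iff less_imp_le order_trans subsetI)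
    then show ?thesis
      using slope_left_antimono[OF _ _ B(1)[OF a(3), unfolded r] cont(1)
          B(2)[OF a(3), unfolded r] cont(2) le' eq] a(2)
      by (simp add: Backward r)
  qed
qed

section \<open>Points at infinity\<close>

text \<open>The last clause of \<open>tropical_curve_def\<close> excludes every other edge and
  parameter, and \<open>Forward\<close> would require a parameter below the length.\<close>

lemma tangents_at_infinity:
  assumes "tropical_curve \<Gamma>" and "e \<in> edges \<Gamma>" and "elen \<Gamma> e = \<infinity>"
  shows "tangents \<Gamma> (chart \<Gamma> e \<infinity>) = {(e, \<infinity>, Backward)}"
proof -
  have unique: "e' = e \<and> t = \<infinity>"
    if "e' \<in> edges \<Gamma>" "0 \<le> t" "t \<le> elen \<Gamma> e'" "chart \<Gamma> e' t = chart \<Gamma> e \<infinity>" for e' t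
    using assms that unfolding tropical_curve_def by (meson atLeastAtMost_iff)
  have "v = (e, \<infinity>, Backward)" if v: "v \<in> tangents \<Gamma> (chart \<Gamma> e \<infinity>)" for v
  proof -
    obtain e' t d where [simp]: "v = (e', t, d)" by (cases v)
    have "e' = e \<and> t = \<infinity>"
      using v by (intro unique) (auto simp: tangents_def)
    then show ?thesis
      using v by (auto simp: tangents_def)
  qed
  moreover have "(e, \<infinity>, Backward) \<in> tangents \<Gamma> (chart \<Gamma> e \<infinity>)"
    using assms(2,3) by (simp add: tangents_def)
  ultimately show ?thesis
    by blast
qed

text \<open>Domination does not bound orders here: functions of slope 1 and 2 towards infinity both
  have value \<infinity> there, but the larger one has order -2 and the smaller one -1. Hence germs
  are compared instead of values.\<close>

lemma ord_at_infinity_trop_add: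
  assumes \<Gamma>: "tropical_curve \<Gamma>"
    and f: "rational_function \<Gamma> f" and g: "rational_function \<Gamma> g"
    and x: "x \<in> points_at_infinity \<Gamma>"
  shows "ord_at \<Gamma> (f \<oplus>\<^sub>t g) x = ord_at \<Gamma> f x \<or> ord_at \<Gamma> (f \<oplus>\<^sub>t g) x = ord_at \<Gamma> g x"
proof -
  obtain e where e: "e \<in> edges \<Gamma>" "elen \<Gamma> e = \<infinity>" "x = chart \<Gamma> e \<infinity>"
    using x by (auto simp: points_at_infinity_def)
  have pl: "piecewise_linear \<Gamma> f" "piecewise_linear \<Gamma> g"
    using f g by (simp_all add: rational_function_def)
  obtain B where "finite B" and B:
    "\<And>a b. {a<..<b} \<subseteq> {0<..<elen \<Gamma> e} - B \<Longrightarrow> affine_between (\<lambda>s. f (chart \<Gamma> e s)) a b"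
    "\<And>a b. {a<..<b} \<subseteq> {0<..<elen \<Gamma> e} - B \<Longrightarrow> affine_between (\<lambda>s. g (chart \<Gamma> e s)) a b"
    "\<And>a b. {a<..<b} \<subseteq> {0<..<elen \<Gamma> e} - B \<Longrightarrow>
       (\<forall>s\<in>{a<..<b}. f (chart \<Gamma> e s) \<le> g (chart \<Gamma> e s)) \<or>
       (\<forall>s\<in>{a<..<b}. g (chart \<Gamma> e s) \<le> f (chart \<Gamma> e s))"
    using common_subdivision[OF pl e(1)] by blast
  \<comment> \<open>Beyond \<open>a\<close> the infinite edge contains no break points and no sign
    changes of the difference.\<close>
  obtain a where a: "a < \<infinity>" "{a<..<\<infinity>} \<subseteq> {0<..<elen \<Gamma> e} - B"
    using left_piece[OF \<open>finite B\<close>, of \<infinity> "elen \<Gamma> e"] e(2) by auto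
  have near: "\<forall>\<^sub>F s in at_left \<infinity>. P s" if "\<forall>s\<in>{a<..<\<infinity>}. P s" for P
    unfolding eventually_at_left[OF a(1)] using a(1) that by auto
  have "slope_along (\<lambda>s. (f \<oplus>\<^sub>t g) (chart \<Gamma> e s)) (at_left \<infinity>)
      \<in> {slope_along (\<lambda>s. f (chart \<Gamma> e s)) (at_left \<infinity>), slope_along (\<lambda>s. g (chart \<Gamma> e s)) (at_left \<infinity>)}"
    using B(3)[OF a(2)]
  proof
    assume "\<forall>s\<in>{a<..<\<infinity>}. f (chart \<Gamma> e s) \<le> g (chart \<Gamma> e s)"
    then have "\<forall>\<^sub>F s in at_left \<infinity>. (f \<oplus>\<^sub>t g) (chart \<Gamma> e s) = g (chart \<Gamma> e s)"
      by (intro near) (auto simp: trop_add_def max_absorb2)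
    then show ?thesis
      by (auto dest: slope_along_cong)
  next
    assume "\<forall>s\<in>{a<..<\<infinity>}. g (chart \<Gamma> e s) \<le> f (chart \<Gamma> e s)"
    then have "\<forall>\<^sub>F s in at_left \<infinity>. (f \<oplus>\<^sub>t g) (chart \<Gamma> e s) = f (chart \<Gamma> e s)"
      by (intro near) (auto simp: trop_add_def max_absorb1)
    then show ?thesis
      by (auto dest: slope_along_cong)
  qed
  then show ?thesis
    using tangents_at_infinity[OF \<Gamma> e(1,2)] e(3) by (auto simp: ord_at_def)
qed

section \<open>Orders of tropical sums and membership in \<open>R\<close>\<close>

text \<open>A lower bound by the minimum suffices, since membership of \<open>f\<close> and
  \<open>g\<close> in \<open>R\<close> bounds both orders at \<open>x\<close> below by the same
  number, the negative of the coefficient of \<open>D\<close>.\<close>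

lemma ord_at_trop_add:
  assumes "tropical_curve \<Gamma>" and "rational_function \<Gamma> f" and "rational_function \<Gamma> g"
  shows "min (ord_at \<Gamma> f x) (ord_at \<Gamma> g x) \<le> ord_at \<Gamma> (f \<oplus>\<^sub>t g) x"
proof (cases "x \<in> points_at_infinity \<Gamma>")
  case True
  then show ?thesis
    using ord_at_infinity_trop_add[OF assms] by fastforce
next
  case False
  note h = rational_function_trop_add[OF assms(2,3)]
  have "f x = (f \<oplus>\<^sub>t g) x \<or> g x = (f \<oplus>\<^sub>t g) x"
    by (auto simp: trop_add_def max_def)
  then show ?thesis
    using ord_at_mono[OF assms(1,2) h _ False] ord_at_mono[OF assms(1,3) h _ False]
    by (auto simp: trop_add_def min_le_iff_disj)
qed

lemma R_iff_ord_at: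
  assumes "tropical_curve \<Gamma>" and "divisor \<Gamma> D"
  shows "f \<in> R \<Gamma> D \<longleftrightarrow> rational_function \<Gamma> f \<and>
    (\<forall>x\<in>points \<Gamma>. 0 \<le> Poly_Mapping.lookup D x + ord_at \<Gamma> f x)"
proof -
  \<comment> \<open>\<open>effective\<close> quantifies over the whole type, so elements outside the
    curve are treated too. There both coefficients vanish.\<close>
  have "Poly_Mapping.lookup D x + Poly_Mapping.lookup (principal_divisor \<Gamma> f) x = 0"
    if "x \<notin> points \<Gamma>" for x
  proof -
    have "Poly_Mapping.lookup D x = 0"
      using assms(2) that by (auto simp: divisor_def in_keys_iff)
    moreover have "Poly_Mapping.lookup (principal_divisor \<Gamma> f) x = 0"
      using that by (auto simp: principal_divisor_def lookup_sum lookup_single when_def intro!: sum.neutral)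
    ultimately show ?thesis by simp
  qed
  then have "0 \<le> Poly_Mapping.lookup (D + principal_divisor \<Gamma> f) x \<longleftrightarrow>
      (x \<in> points \<Gamma> \<longrightarrow> 0 \<le> Poly_Mapping.lookup D x + ord_at \<Gamma> f x)"
    if "rational_function \<Gamma> f" for x
    using lookup_principal_divisor[OF assms(1) that, of x]
    by (cases "x \<in> points \<Gamma>") (simp_all add: lookup_add)
  then show ?thesis
    by (auto simp: R_def effective_def)
qed

theorem lemma4:
  fixes \<Gamma> :: "('p, 'e) metric_graph" and D :: "'p \<Rightarrow>\<^sub>0 int"
  assumes "tropical_curve \<Gamma>" and "divisor \<Gamma> D"
  shows "(\<forall>f\<in>R \<Gamma> D. \<forall>g\<in>R \<Gamma> D. f \<oplus>\<^sub>t g \<in> R \<Gamma> D) \<and>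
         (\<forall>a::real. \<forall>f\<in>R \<Gamma> D. a \<odot>\<^sub>t f \<in> R \<Gamma> D)"
proof (intro conjI allI ballI)
  fix f g assume f: "f \<in> R \<Gamma> D" and g: "g \<in> R \<Gamma> D"
  have "0 \<le> Poly_Mapping.lookup D x + ord_at \<Gamma> (f \<oplus>\<^sub>t g) x" if "x \<in> points \<Gamma>" for x
  proof -
    have "0 \<le> Poly_Mapping.lookup D x + min (ord_at \<Gamma> f x) (ord_at \<Gamma> g x)"
      using f g that by (auto simp: R_iff_ord_at[OF assms] min_def)
    also have "\<dots> \<le> Poly_Mapping.lookup D x + ord_at \<Gamma> (f \<oplus>\<^sub>t g) x"
      using ord_at_trop_add[OF assms(1)] f g by (auto simp: R_iff_ord_at[OF assms])
    finally show ?thesis .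
  qed
  then show "f \<oplus>\<^sub>t g \<in> R \<Gamma> D"
    using f g by (auto simp: R_iff_ord_at[OF assms] rational_function_trop_add)
next
  fix a :: real and f assume "f \<in> R \<Gamma> D"
  then show "a \<odot>\<^sub>t f \<in> R \<Gamma> D"
    by (auto simp: R_iff_ord_at[OF assms] rational_function_trop_smult ord_at_trop_smult)
qed

end
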